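(* Let $t\ge1$ be an integer and consider the grid peeling of the grid parabola $P_t$, i.e., the sequence $U_0,U_1,\dots$ with $U_0$ the set of points of $\Lambda_t$ lying on or above $P_t$. If $t$ is odd, then $U_t=U_0+(0,1)$. If $t$ is even, then $U_{t+1}=U_0+(0,1)$. (That is, $P_t$ reappears, translated one unit upward, after $t$ peeling steps when $t$ is odd and after $t+1$ steps when $t$ is even.)
   Context: Fix an integer $t\ge1$. Let $S_t$ be the set of rational numbers $s$ which, written in lowest terms as $s=a/b$ with $a\in\mathbb Z$ and $b$ a positive integer, satisfy $b\le t$. For $s=a/b\in S_t$ let $v_s=\lfloor t/b\rfloor\,(b,a)$ (the longest integer multiple $q(b,a)$, $q\in\mathbb Z$, with $0<qb\le t$), and let $V_t=\{v_s: s\in S_t\}$. The grid parabola $P_t$ is the infinite convex polygonal chain obtained by concatenating the vectors of $V_t$ in order of increasing slope, positioned so that the edge given by the vector $(t,0)$ (slope $0$) goes from $(-t/2,0)$ to $(t/2,0)$. Its vertices lie in the lattice $\Lambda_t=(\tfrac t2+\mathbb Z)\times\mathbb Z$, called the grid. Peeling: one step applied to a set $U$ of points removes from $U$ all vertices (extreme points) of $\mathrm{conv}(U)$; the grid peeling of $P_t$ is $U_0=$ the points of $\Lambda_t$ on or above $P_t$ and $U_{k+1}=U_k\setminus\{\text{vertices of }\mathrm{conv}(U_k)\}$. *)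

theory Defs
  imports "HOL-Analysis.Analysis"
begin

definition slopes :: "nat \<Rightarrow> rat set" where
  "slopes t = {s. snd (quotient_of s) \<le> int t}"

definition gvec :: "nat \<Rightarrow> rat \<Rightarrow> real \<times> real" where
  "gvec t s = (case quotient_of s of (a, b) \<Rightarrow>
      (of_int ((int t div b) * b), of_int ((int t div b) * a)))"

definition right_end :: "nat \<Rightarrow> rat \<Rightarrow> real \<times> real" where
  "right_end t s = (real t / 2, 0) + (\<Sum>s'\<in>{s' \<in> slopes t. 0 < s' \<and> s' \<le> s}. gvec t s')"

definition left_end :: "nat \<Rightarrow> rat \<Rightarrow> real \<times> real" where
  "left_end t s = (- real t / 2, 0) - (\<Sum>s'\<in>{s' \<in> slopes t. s \<le> s' \<and> s' < 0}. gvec t s')"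

definition edge :: "nat \<Rightarrow> rat \<Rightarrow> (real \<times> real) set" where
  "edge t s =
     (if s = 0 then closed_segment (- real t / 2, 0) (real t / 2, 0)
      else if 0 < s then closed_segment (right_end t s - gvec t s) (right_end t s)
      else closed_segment (left_end t s) (left_end t s + gvec t s))"

definition grid_parabola :: "nat \<Rightarrow> (real \<times> real) set" where
  "grid_parabola t = (\<Union>s\<in>slopes t. edge t s)"

definition grid :: "nat \<Rightarrow> (real \<times> real) set" where
  "grid t = {(x, y). \<exists>m n :: int. x = real t / 2 + of_int m \<and> y = of_int n}"

definition U0 :: "nat \<Rightarrow> (real \<times> real) set" where
  "U0 t = {p \<in> grid t. \<exists>q \<in> grid_parabola t. fst q = fst p \<and> snd q \<le> snd p}"

definition peel :: "(real \<times> real) set \<Rightarrow> (real \<times> real) set" where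
  "peel U = U - {x. x extreme_point_of (convex hull U)}"

end

theory Submission
  imports Defs
begin

text \<open>
  Let \<open>n = \<lfloor>t/2\<rfloor>\<close> and \<open>T = 2n + 1\<close>, so \<open>T\<close> is the claimed period. Every vertex \<open>v\<close> of the grid
  parabola lies between two edges whose slopes \<open>s < s'\<close> are neighbours in the Farey sequence of
  order \<open>t\<close>. Two points of the strip of the \<open>T\<close> grid columns centred at \<open>v\<close> differ by at most \<open>t\<close>
  horizontally, while every slope strictly between \<open>s\<close> and \<open>s'\<close> has a denominator larger than \<open>t\<close>;
  hence all directions between \<open>s\<close> and \<open>s'\<close> sweep the strip in the same order. During the peeling
  the vertex walks through the strip in exactly this order, one grid point per step. Since each
  column of the strip is met once before \<open>v + (0,1)\<close> is reached, this takes \<open>T\<close> steps.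

  The two endpoints of an edge of slope \<open>s = a/b\<close> traverse the grid points of a line of slope \<open>s\<close>
  in their strips in opposite directions and change to the next line simultaneously. At that
  moment they are at most one multiple of \<open>(b,a)\<close> apart, so no other grid point is left on the line.
\<close>

section \<open>Farey neighbours\<close>

definition num :: "rat \<Rightarrow> int" where "num s = fst (quotient_of s)"
definition den :: "rat \<Rightarrow> int" where "den s = snd (quotient_of s)"

lemma den_pos: "den s > 0"
  by (simp add: den_def quotient_of_denom_pos')

lemma coprime_num_den: "coprime (num s) (den s)"
  using quotient_of_coprime[of s "num s" "den s"] by (simp add: num_def den_def)

lemma rat_num_den: "s = of_int (num s) / of_int (den s)"
  using quotient_of_div[of s "num s" "den s"] by (simp add: num_def den_def)

lemma less_num_den: "r < s \<longleftrightarrow> num r * den s < num s * den r"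
proof -
  have "r < s \<longleftrightarrow> (of_int (num r) / of_int (den r) :: rat) < of_int (num s) / of_int (den s)"
    using rat_num_den[of r] rat_num_den[of s] by simp
  also have "\<dots> \<longleftrightarrow> (of_int (num r * den s) :: rat) < of_int (num s * den r)"
    using den_pos[of r] den_pos[of s] by (simp add: field_simps)
  finally show ?thesis by (simp only: of_int_less_iff)
qed

lemma le_num_den: "r \<le> s \<longleftrightarrow> num r * den s \<le> num s * den r"
  using less_num_den[of s r] by (simp add: not_less[symmetric] mult.commute)

lemma num_den_Fract:
  assumes "coprime a b" "b > 0"
  shows "num (Fract a b) = a" "den (Fract a b) = b"
  using assms by (simp_all add: num_def den_def quotient_of_Fract normalize_def coprime_iff_gcd_eq_1)

lemma num_den_uminus: "num (- s) = - num s" "den (- s) = den s"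
  by (simp_all add: num_def den_def rat_uminus_code Let_def split: prod.split)

lemma num_den_of_int: "num (of_int m) = m" "den (of_int m) = 1"
  by (simp_all add: num_def den_def)

lemma slopes_iff: "s \<in> slopes t \<longleftrightarrow> den s \<le> int t"
  by (simp add: slopes_def den_def)

lemma finite_slopes: "finite {s \<in> slopes t. p \<le> s \<and> s \<le> q}"
proof -
  obtain m :: nat where m: "\<bar>p\<bar> \<le> of_nat m" "\<bar>q\<bar> \<le> of_nat m"
    using real_arch_simple[of "max \<bar>p\<bar> \<bar>q\<bar>"] by auto
  let ?B = "int m * int t"
  have "{s \<in> slopes t. p \<le> s \<and> s \<le> q} \<subseteq> (\<lambda>(a, b). of_int a / of_int b) ` ({-?B..?B} \<times> {0..int t})"
  proof clarify
    fix s assume s: "s \<in> slopes t" "p \<le> s" "s \<le> q"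
    have "s \<le> of_int (int m)" "of_int (- int m) \<le> s" using s m by auto
    then have "num s \<le> int m * den s" "- int m * den s \<le> num s"
      using num_den_of_int[of "int m"] num_den_of_int[of "- int m"]
      unfolding le_num_den by simp_all
    moreover have "int m * den s \<le> ?B" using s by (intro mult_left_mono) (auto simp: slopes_iff)
    ultimately have "num s \<in> {-?B..?B}" "den s \<in> {0..int t}"
      using s den_pos[of s] by (auto simp: slopes_iff)
    then show "s \<in> (\<lambda>(a, b). of_int a / of_int b) ` ({-?B..?B} \<times> {0..int t})"
      using rat_num_den[of s] by (intro image_eqI[of _ _ "(num s, den s)"]) auto
  qed
  then show ?thesis by (rule finite_subset) auto
qed

text \<open>The open half-space where \<open>c\<close> exceeds its value at \<open>x\<close>,
  together with \<open>x\<close> itself, is convex and contains the hull of \<open>U\<close>;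
  \<open>x\<close> is extreme in it because deleting \<open>x\<close> leaves a convex set.\<close>

lemma extreme_point_of_unique_min:
  fixes x c :: "'a::real_inner"
  assumes "x \<in> U" and min: "\<And>y. y \<in> U \<Longrightarrow> y \<noteq> x \<Longrightarrow> c \<bullet> x < c \<bullet> y"
  shows "x extreme_point_of (convex hull U)"
proof -
  define C where "C = insert x {y. c \<bullet> x < c \<bullet> y}"
  have strict: "c \<bullet> x < c \<bullet> (u *\<^sub>R y + v *\<^sub>R z)"
    if "y \<in> C" "c \<bullet> x < c \<bullet> z" "u \<ge> 0" "v > 0" "u + v = 1" for y z u v
  proof -
    have "c \<bullet> x = u * (c \<bullet> x) + v * (c \<bullet> x)"
      using that(5) by (simp add: distrib_right[symmetric])
    also have "\<dots> < u * (c \<bullet> y) + v * (c \<bullet> z)"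
      using that by (intro add_le_less_mono mult_left_mono mult_strict_left_mono) (auto simp: C_def)
    finally show ?thesis by (simp add: inner_add_right)
  qed
  have conv: "convex C"
  proof (rule convexI)
    fix y z u v assume *: "y \<in> C" "z \<in> C" "(0::real) \<le> u" "0 \<le> v" "u + v = 1"
    show "u *\<^sub>R y + v *\<^sub>R z \<in> C"
    proof (cases "u = 0 \<or> v = 0 \<or> y = x \<and> z = x")
      case True
      then show ?thesis using * by (auto simp: scaleR_left_distrib[symmetric])
    next
      case False
      then have "c \<bullet> x < c \<bullet> z \<or> c \<bullet> x < c \<bullet> y" using * by (auto simp: C_def)
      then show ?thesis
        using strict[of y z u v] strict[of z y v u] * False by (auto simp: C_def add.commute)
    qed
  qed
  have "convex (C - {x})"
  proof -
    have "C - {x} = {y. c \<bullet> y > c \<bullet> x}" by (auto simp: C_def)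
    then show ?thesis by (simp add: convex_halfspace_gt)
  qed
  then have "x extreme_point_of C" using conv by (simp add: extreme_point_of_stillconvex C_def)
  moreover have "convex hull U \<subseteq> C" using min conv by (intro hull_minimal) (auto simp: C_def)
  ultimately show ?thesis
    using assms(1) hull_subset[of U convex] unfolding extreme_point_of_def by blast
qed

locale grid_peeling =
  fixes t :: nat
  assumes t_pos: "t \<ge> 1"
begin

text \<open>Consecutive fractions of the Farey sequence of order \<open>t\<close>, by the classical
  criterion: determinant 1, and a mediant whose denominator exceeds \<open>t\<close>.\<close>

definition adj :: "rat \<Rightarrow> rat \<Rightarrow> bool" where
  "adj r s \<longleftrightarrow> r \<in> slopes t \<and> s \<in> slopes t \<and>
     num s * den r - num r * den s = 1 \<and> den r + den s > int t"

lemma adj_slopes: assumes "adj r s" shows "r \<in> slopes t" "s \<in> slopes t"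
  using assms by (auto simp: adj_def)

lemma adj_less: "adj r s \<Longrightarrow> r < s"
  by (auto simp: adj_def less_num_den)

lemma adj_uminus: "adj (- s) (- r) \<longleftrightarrow> adj r s"
  by (auto simp: adj_def num_den_uminus slopes_iff algebra_simps)

text \<open>By the unit determinant, \<open>den q\<close> is an integer combination of
  \<open>den r\<close> and \<open>den s\<close>; strictly between \<open>r\<close> and
  \<open>s\<close> both coefficients are positive, so \<open>den q\<close> would exceed
  \<open>t\<close>.\<close>

lemma adj_no_between:
  assumes "adj r s" "q \<in> slopes t" shows "q \<le> r \<or> s \<le> q"
proof (rule ccontr)
  assume "\<not> (q \<le> r \<or> s \<le> q)"
  then have "r < q" "q < s" by auto
  then have 1: "num q * den r - num r * den q \<ge> 1" "num s * den q - num q * den s \<ge> 1"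
    unfolding less_num_den by simp_all
  have "den q = den q * (num s * den r - num r * den s)" using assms by (simp add: adj_def)
  also have "\<dots> = den r * (num s * den q - num q * den s) + den s * (num q * den r - num r * den q)"
    by (simp add: algebra_simps)
  also have "\<dots> \<ge> den r * 1 + den s * 1"
    using 1 den_pos[of r] den_pos[of s] by (intro add_mono mult_left_mono) auto
  finally show False using assms by (simp add: adj_def slopes_iff)
qed

lemma ex_adj_right:
  assumes "s \<in> slopes t" shows "\<exists>s'. adj s s'"
proof -
  let ?a = "num s" and ?b = "den s"
  obtain u v where uv: "u * ?a + v * ?b = 1"
    using bezout_int[of ?a ?b] coprime_num_den[of s] by (auto simp: coprime_iff_gcd_eq_1)
  \<comment> \<open>The denominator must be congruent to \<open>- u\<close> modulo
    \<open>?b\<close>; its representative in (t - ?b, t] makes the sum of denominators exceed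
    \<open>t\<close>.\<close>
  define b' where "b' = int t - (int t + u) mod ?b"
  have b': "int t - ?b < b'" "b' \<le> int t"
    using den_pos[of s] pos_mod_bound[of ?b "int t + u"] pos_mod_sign[of ?b "int t + u"]
    by (auto simp: b'_def simp del: pos_mod_bound pos_mod_sign)
  have pos: "b' > 0" using b' assms by (simp add: slopes_iff)
  have "?b dvd b' + u"
  proof -
    have eq: "b' + u = (int t + u) - (int t + u) mod ?b" by (simp add: b'_def)
    show ?thesis unfolding eq by (rule dvd_minus_mod)
  qed
  then obtain w where w: "b' = ?b * w - u" by (metis add_diff_cancel_right' dvdE)
  define a' where "a' = v + ?a * w"
  have det: "a' * ?b - ?a * b' = 1" using uv by (simp add: a'_def w algebra_simps)
  have "coprime a' b'"
  proof (rule coprimeI)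
    fix c assume "c dvd a'" "c dvd b'"
    then have "c dvd a' * ?b - ?a * b'" by auto
    then show "is_unit c" using det by simp
  qed
  then have "adj s (Fract a' b')"
    using assms det b' pos num_den_Fract[of a' b'] by (auto simp: adj_def slopes_iff)
  then show ?thesis ..
qed

lemma ex_adj_left:
  assumes "s \<in> slopes t" shows "\<exists>r. adj r s"
proof -
  obtain s' where "adj (- s) s'"
    using ex_adj_right[of "- s"] assms by (auto simp: slopes_iff num_den_uminus)
  then show ?thesis using adj_uminus[of s "- s'"] by auto
qed

definition nxt :: "rat \<Rightarrow> rat" where "nxt s = (SOME s'. adj s s')"

lemma adj_nxt: "s \<in> slopes t \<Longrightarrow> adj s (nxt s)"
  unfolding nxt_def using ex_adj_right by (rule someI_ex)

lemma nxt_eq: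
  assumes "adj r s" shows "nxt r = s"
proof -
  have *: "adj r (nxt r)" using assms adj_nxt adj_slopes by blast
  have "s \<le> nxt r"
    using adj_no_between[OF assms adj_slopes(2)[OF *]] adj_less[OF *] by simp
  moreover have "nxt r \<le> s"
    using adj_no_between[OF * adj_slopes(2)[OF assms]] adj_less[OF assms] by simp
  ultimately show ?thesis by simp
qed

text \<open>Bounded intervals contain finitely many slopes, so a finite chain of neighbours leads
  from \<open>r\<close> to \<open>s\<close>.\<close>

lemma adj_induct [consumes 3, case_names base step]:
  assumes "r \<in> slopes t" "s \<in> slopes t" "r \<le> s"
    and base: "P r"
    and step: "\<And>p q. adj p q \<Longrightarrow> r \<le> p \<Longrightarrow> P p \<Longrightarrow> P q"
  shows "P s"
  using assms(2,3)
proof (induction "card {q \<in> slopes t. r \<le> q \<and> q \<le> s}" arbitrary: s rule: less_induct)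
  case less
  show ?case
  proof (cases "s = r")
    case False
    obtain p where p: "adj p s" using ex_adj_left less.prems by blast
    have rp: "r \<le> p" using adj_no_between[OF p assms(1)] less.prems False by auto
    have "{q \<in> slopes t. r \<le> q \<and> q \<le> p} \<subseteq> {q \<in> slopes t. r \<le> q \<and> q \<le> s}"
      and "s \<in> {q \<in> slopes t. r \<le> q \<and> q \<le> s} - {q \<in> slopes t. r \<le> q \<and> q \<le> p}"
      using adj_less[OF p] less.prems by auto
    then have "{q \<in> slopes t. r \<le> q \<and> q \<le> p} \<subset> {q \<in> slopes t. r \<le> q \<and> q \<le> s}"
      by blast
    then have "card {q \<in> slopes t. r \<le> q \<and> q \<le> p} < card {q \<in> slopes t. r \<le> q \<and> q \<le> s}"
      by (intro psubset_card_mono finite_slopes)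
    then have "P p" using less.hyps rp adj_slopes[OF p] by blast
    then show ?thesis using step p rp by blast
  qed (use base in simp)
qed

lemma adj_induct_down [consumes 3, case_names base step]:
  assumes "r \<in> slopes t" "s \<in> slopes t" "r \<le> s"
    and base: "P s"
    and step: "\<And>p q. adj p q \<Longrightarrow> q \<le> s \<Longrightarrow> P q \<Longrightarrow> P p"
  shows "P r"
proof -
  have neg: "- q \<in> slopes t" if "q \<in> slopes t" for q
    using that by (simp add: slopes_iff num_den_uminus)
  have "- s \<le> - r" using assms(3) by simp
  from neg[OF assms(2)] neg[OF assms(1)] this have "P (- (- r))"
  proof (induction rule: adj_induct)
    case (step p q)
    then show ?case using assms(5)[of "- q" "- p"] adj_uminus by (metis minus_le_iff)
  qed (use base in simp)
  then show ?thesis by simp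
qed

section \<open>The walk of a vertex through its strip\<close>

definition hw :: int where "hw = int t div 2"

lemma hw_bounds: "2 * hw \<le> int t" "int t \<le> 2 * hw + 1"
  by (auto simp: hw_def)

abbreviation dir :: "rat \<Rightarrow> int \<times> int" where "dir s \<equiv> (den s, num s)"

text \<open>The linear form that numbers the grid lines of slope \<open>s\<close> upwards by
  consecutive integers.\<close>

definition lev :: "rat \<Rightarrow> int \<times> int \<Rightarrow> int" where
  "lev s p = den s * snd p - num s * fst p"

lemma lev_add: "lev s (p + q) = lev s p + lev s q"
  by (simp add: lev_def algebra_simps)

lemma lev_diff: "lev s (p - q) = lev s p - lev s q"
  by (simp add: lev_def algebra_simps)

lemma lev_mult: "lev s (c * fst p, c * snd p) = c * lev s p"
  by (simp add: lev_def algebra_simps)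

lemma lev_dir_adj:
  assumes "adj r s" shows "lev r (dir s) = 1" "lev s (dir r) = - 1" "lev s (dir s) = 0"
  using assms by (auto simp: adj_def lev_def algebra_simps)

lemma lev_dir_pos: "r < s \<Longrightarrow> lev r (dir s) > 0"
  by (simp add: less_num_den lev_def algebra_simps)

lemma lev_dir_neg: "s < r \<Longrightarrow> lev r (dir s) < 0"
  by (simp add: less_num_den lev_def algebra_simps)

lemma lev_eq_zero:
  assumes "lev s p = 0" obtains j where "p = (j * den s, j * num s)"
proof -
  have e: "den s * snd p = num s * fst p" using assms by (simp add: lev_def)
  then have "den s dvd num s * fst p" by (metis dvd_triv_left)
  then have "den s dvd fst p"
    using coprime_num_den[of s] by (simp add: coprime_commute coprime_dvd_mult_right_iff)
  then obtain j where j: "fst p = den s * j" ..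
  then have "den s * snd p = den s * (j * num s)" using e by (simp add: mult_ac)
  then have "snd p = j * num s" using den_pos[of s] by (simp only: mult_cancel_left) auto
  then show thesis using j that[of j] by (simp add: prod_eq_iff)
qed

text \<open>
  The successor of \<open>p\<close> in the strip \<open>\<bar>x\<bar> \<le> hw\<close>, ordered by any direction strictly between \<open>s\<close> and
  \<open>nxt s\<close>. The first two cases exclude each other since \<open>den s + den (nxt s) > t \<ge> 2 hw\<close>.
\<close>
definition walk_step :: "rat \<Rightarrow> int \<times> int \<Rightarrow> int \<times> int" where
  "walk_step s p =
     (if - hw \<le> fst p - den s then p - dir s
      else if fst p + den (nxt s) \<le> hw then p + dir (nxt s)
      else p - dir s + dir (nxt s))"

text \<open>Seen from the edge of slope \<open>s\<close> that ends at this vertex: the vertex slides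
  left until the strip leaves no room, then restarts at the rightmost strip point of the next
  line.\<close>

lemma walk_step_right:
  assumes "adj s s'" "- hw \<le> fst p" "fst p \<le> hw"
  shows "- hw \<le> fst p - den s \<Longrightarrow> walk_step s p = p - dir s"
    and "fst p - den s < - hw \<Longrightarrow>
      lev s (walk_step s p) = lev s p + 1 \<and> hw - den s < fst (walk_step s p) \<and> fst (walk_step s p) \<le> hw"
proof -
  have b: "den s + den s' > int t" "den s \<le> int t" "den s' \<le> int t"
    using assms by (auto simp: adj_def slopes_iff)
  note l = lev_dir_adj[OF assms(1)] lev_def[of s "dir s"]
  show "- hw \<le> fst p - den s \<Longrightarrow> walk_step s p = p - dir s" by (simp add: walk_step_def)
  show "lev s (walk_step s p) = lev s p + 1 \<and> hw - den s < fst (walk_step s p) \<and> fst (walk_step s p) \<le> hw"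
    if "fst p - den s < - hw"
    using that b hw_bounds assms(2,3)
    by (auto simp: walk_step_def nxt_eq[OF assms(1)] lev_add lev_diff l)
qed

text \<open>The mirror image at the left end of the edge of slope \<open>s\<close>.\<close>

lemma walk_step_left:
  assumes "adj r s" "- hw \<le> fst p" "fst p \<le> hw"
  shows "fst p + den s \<le> hw \<Longrightarrow> walk_step r p = p + dir s"
    and "hw < fst p + den s \<Longrightarrow>
      lev s (walk_step r p) = lev s p + 1 \<and> - hw \<le> fst (walk_step r p) \<and> fst (walk_step r p) < - hw + den s"
proof -
  have b: "den r + den s > int t" "den r \<le> int t" "den s \<le> int t"
    using assms by (auto simp: adj_def slopes_iff)
  note l = lev_dir_adj[OF assms(1)]
  show "fst p + den s \<le> hw \<Longrightarrow> walk_step r p = p + dir s"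
    using b hw_bounds by (auto simp: walk_step_def nxt_eq[OF assms(1)])
  show "lev s (walk_step r p) = lev s p + 1 \<and> - hw \<le> fst (walk_step r p) \<and> fst (walk_step r p) < - hw + den s"
    if "hw < fst p + den s"
    using that b hw_bounds assms(2,3)
    by (auto simp: walk_step_def nxt_eq[OF assms(1)] lev_add lev_diff l)
qed

definition walk :: "rat \<Rightarrow> nat \<Rightarrow> int \<times> int" where
  "walk s k = (walk_step s ^^ k) (0, 0)"

lemma walk_0: "walk s 0 = (0, 0)" and walk_Suc: "walk s (Suc k) = walk_step s (walk s k)"
  by (simp_all add: walk_def)

lemma walk_strip:
  assumes "s \<in> slopes t" shows "- hw \<le> fst (walk s k) \<and> fst (walk s k) \<le> hw"
proof (induction k)
  case 0
  then show ?case using hw_bounds by (simp add: walk_0)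
next
  case (Suc k)
  have "den s \<le> int t" "den s > 0" using assms den_pos by (auto simp: slopes_iff)
  then show ?case
    using walk_step_right[OF adj_nxt[OF assms], of "walk s k"] Suc hw_bounds
    by (cases "- hw \<le> fst (walk s k) - den s") (auto simp: walk_Suc)
qed

text \<open>
  The walks at the left end (index \<open>r\<close>) and at the right end (index \<open>s\<close>) of the edge of slope \<open>s\<close>,
  where \<open>lo\<close> and \<open>hi\<close> are the outermost columns of the strip with a grid point on the current line.
\<close>
lemma walk_sync:
  assumes "adj r s"
  shows "lev s (walk r k) = lev s (walk s k) \<and>
    (\<exists>lo hi. - hw \<le> lo \<and> lo < - hw + den s \<and> hw - den s < hi \<and> hi \<le> hw \<and>
      den s dvd fst (walk s k) - lo \<and> den s dvd hi - lo \<and>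
      fst (walk r k) + fst (walk s k) = lo + hi)"
proof (induction k)
  case 0
  \<comment> \<open>The largest multiple of \<open>den s\<close> within \<open>hw\<close>: the line
    through the origin has its outermost strip points in columns \<open>- ?m\<close> and
    \<open>?m\<close>.\<close>
  let ?m = "hw div den s * den s"
  have "?m = hw - hw mod den s" by (simp add: minus_mod_eq_div_mult)
  then have "?m \<le> hw" "hw - den s < ?m" using den_pos[of s] by (auto simp: pos_mod_bound)
  then show ?case
    by (intro conjI exI[of _ "- ?m"] exI[of _ "?m"]) (auto simp: walk_0 lev_def)
next
  case (Suc k)
  let ?p = "walk s k" and ?q = "walk r k"
  note sl = adj_slopes[OF assms]
  from Suc obtain lo hi where lev: "lev s ?q = lev s ?p"
    and b: "- hw \<le> lo" "lo < - hw + den s" "hw - den s < hi" "hi \<le> hw"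
    and d: "den s dvd fst ?p - lo" "den s dvd hi - lo" and sum: "fst ?q + fst ?p = lo + hi"
    by blast
  note R = walk_step_right[OF adj_nxt[OF sl(2)], of ?p] and L = walk_step_left[OF assms, of ?q]
  note strip = walk_strip[OF sl(1), of k] walk_strip[OF sl(2), of k]
  show ?case
  proof (cases "- hw \<le> fst ?p - den s")
    case True
    then have "den s \<le> fst ?p - lo"
      using b d by (intro zdvd_imp_le) auto
    then have "fst ?q + den s \<le> hw" using sum b by simp
    then have "walk_step r ?q = ?q + dir s" "walk_step s ?p = ?p - dir s"
      using L R True strip by auto
    moreover have "den s dvd fst ?p - den s - lo"
      using dvd_diff[OF d(1) dvd_refl] by (simp add: algebra_simps)
    ultimately show ?thesis
      using lev b d sum lev_dir_adj[OF assms]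
      by (intro conjI exI[of _ lo] exI[of _ hi]) (auto simp: walk_Suc lev_add lev_diff)
  next
    case False
    \<comment> \<open>The right end is at \<open>lo\<close>, hence the left end is at
      \<open>hi\<close>, and both change lines in this step.\<close>
    have "fst ?p = lo"
    proof -
      have "\<bar>fst ?p - lo\<bar> < den s" using False b strip unfolding abs_less_iff by linarith
      then show ?thesis using d(1) dvd_imp_le_int[of "fst ?p - lo" "den s"] den_pos[of s] by auto
    qed
    then have "hw < fst ?q + den s" using sum b by simp
    then have L': "lev s (walk_step r ?q) = lev s ?q + 1"
        "- hw \<le> fst (walk_step r ?q)" "fst (walk_step r ?q) < - hw + den s"
      and R': "lev s (walk_step s ?p) = lev s ?p + 1"
        "hw - den s < fst (walk_step s ?p)" "fst (walk_step s ?p) \<le> hw"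
      using L R False strip by auto
    have "lev s (walk_step s ?p - walk_step r ?q) = 0" using L' R' lev by (simp add: lev_diff)
    then obtain j where "walk_step s ?p - walk_step r ?q = (j * den s, j * num s)"
      by (rule lev_eq_zero)
    then have "fst (walk_step s ?p) - fst (walk_step r ?q) = j * den s" by (simp add: prod_eq_iff)
    then have "den s dvd fst (walk_step s ?p) - fst (walk_step r ?q)" by simp
    then show ?thesis
      using L' R' lev
      by (intro conjI exI[of _ "fst (walk_step r ?q)"] exI[of _ "fst (walk_step s ?p)"]) (auto simp: walk_Suc)
  qed
qed

text \<open>\<open>L\<close> is the length of the edge in units of \<open>(den s, num s)\<close>.
  With \<open>m\<close> units initially, \<open>g\<close> units between the outermost columns and
  \<open>i\<close> units left to slide, L = m + 2 i - g. A line change needs i = 0, and then m \<le>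
  g + 1 gives L \<le> 1.\<close>

lemma walk_gap:
  assumes "adj r s"
  obtains L where "walk s k + (int t div den s * den s, int t div den s * num s)
      = walk r k + (L * den s, L * num s)"
    and "L \<ge> 0"
    and "lev s (walk s (Suc k)) = lev s (walk s k) \<or>
      lev s (walk s (Suc k)) = lev s (walk s k) + 1 \<and> L \<le> 1"
proof -
  let ?p = "walk s k" and ?q = "walk r k" and ?b = "den s"
  define m where "m = int t div ?b"
  note sl = adj_slopes[OF assms]
  from walk_sync[OF assms, of k] obtain lo hi where lev: "lev s ?q = lev s ?p"
    and b: "- hw \<le> lo" "lo < - hw + den s" "hw - den s < hi" "hi \<le> hw"
    and d: "den s dvd fst ?p - lo" "den s dvd hi - lo" and sum: "fst ?q + fst ?p = lo + hi"
    by blast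
  obtain i where i: "fst ?p = lo + ?b * i" using d(1) by (metis add.commute diff_add_cancel dvdE)
  obtain g where g: "hi = lo + ?b * g" using d(2) by (metis add.commute diff_add_cancel dvdE)
  have "lev s (?p - ?q) = 0" using lev by (simp add: lev_diff)
  then obtain j where j: "?p - ?q = (j * ?b, j * num s)" by (rule lev_eq_zero)
  have pos: "?b > 0" by (rule den_pos)
  have "fst ?p - fst ?q = j * ?b" using j by (simp add: prod_eq_iff)
  then have "?b * j = ?b * (2 * i - g)" using sum i g by (simp add: algebra_simps)
  then have jig: "j = 2 * i - g" using pos by simp
  have mt: "m * ?b \<le> int t" "int t < m * ?b + ?b"
    using pos pos_mod_bound[of ?b "int t"] pos_mod_sign[of ?b "int t"] div_mult_mod_eq[of "int t" ?b]
    unfolding m_def by linarith+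
  have "?b * g \<le> int t" using b g hw_bounds by simp
  then have "g * ?b < (m + 1) * ?b" using mt by (simp add: algebra_simps)
  then have gm: "g \<le> m" using pos by simp
  have strip: "- hw \<le> fst ?p" "fst ?p \<le> hw" using walk_strip[OF sl(2)] by auto
  have "- ?b < ?b * i" using i strip b by linarith
  then have "?b * (-1) < ?b * i" by simp
  then have i0: "i \<ge> 0" using pos mult_less_cancel_left_pos[of ?b "-1" i] by linarith
  \<comment> \<open>Both outermost columns lie less than \<open>?b\<close> inside the borders;
    integrality supplies the final 2.\<close>
  have "?b * (g + 2) \<ge> 2 * hw + 2" using b g by (simp add: algebra_simps)
  then have "m * ?b < (g + 2) * ?b" using mt hw_bounds by (simp add: algebra_simps)
  then have mg: "m \<le> g + 1" using pos by simp
  note R = walk_step_right[OF adj_nxt[OF sl(2)] strip]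
  show thesis
  proof (rule that[of "m + j"])
    show "?p + (int t div ?b * ?b, int t div ?b * num s) = ?q + ((m + j) * ?b, (m + j) * num s)"
      using j by (simp add: m_def[symmetric] prod_eq_iff algebra_simps)
    show "0 \<le> m + j" using jig i0 gm by simp
    show "lev s (walk s (Suc k)) = lev s ?p \<or>
      lev s (walk s (Suc k)) = lev s ?p + 1 \<and> m + j \<le> 1"
    proof (cases "- hw \<le> fst ?p - ?b")
      case True
      then show ?thesis using R(1) lev_dir_adj[OF assms] by (simp add: walk_Suc lev_diff)
    next
      case False
      then have "?b * i < ?b * 1" using i b by linarith
      then have "i = 0" using i0 pos mult_less_cancel_left_pos[of ?b i 1] by linarith
      then show ?thesis using R(2) False jig mg by (simp add: walk_Suc)
    qed
  qed
qed

text \<open>The form \<open>f\<close> belongs to the mediant of \<open>s\<close> and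
  \<open>s'\<close> and, since \<open>B > 2 * hw\<close>, is injective on the strip. The walk takes
  its values there in increasing order, and one for each column lies in [0, B); so after
  \<open>2 * hw + 1\<close> steps it stands at level \<open>B\<close>, that of (0, 1).\<close>

lemma walk_period:
  assumes "s \<in> slopes t" shows "walk s (nat (2 * hw + 1)) = (0, 1)"
proof -
  define s' where "s' = nxt s"
  have adj: "adj s s'" using adj_nxt[OF assms] by (simp add: s'_def)
  define A B where "A = num s + num s'" and "B = den s + den s'"
  define f where "f p = lev s p + lev s' p" for p
  have f: "f p = B * snd p - A * fst p" for p
    by (simp add: f_def A_def B_def lev_def algebra_simps)
  have B: "B > 2 * hw" "B > 0"
    using adj hw_bounds den_pos[of s] den_pos[of s'] by (auto simp: adj_def B_def)
  have det: "B * num s' - A * den s' = 1"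
    using adj by (simp add: adj_def A_def B_def algebra_simps)
  \<comment> \<open>\<open>A\<close> is invertible modulo \<open>B\<close>, by
    \<open>det\<close>.\<close>
  have dvd: "B dvd d" if "B dvd A * d" for d
  proof -
    have "B dvd d * num s' * B - A * d * den s'" using that by auto
    also have "d * num s' * B - A * d * den s' = d * (B * num s' - A * den s')"
      by (simp add: algebra_simps)
    finally show ?thesis using det by simp
  qed
  have small: "d = 0" if "B dvd d" "\<bar>d\<bar> < B" for d
    using that dvd_imp_le_int[of d B] by fastforce
  \<comment> \<open>The values of \<open>f\<close> on the strip are exactly the integers in \<open>T\<close> of the \<open>B\<close> residue classes
    modulo \<open>B\<close>; the walk visits them in increasing order and \<open>f (0, 1) = B\<close>.\<close>
  define P where "P i \<longleftrightarrow> (\<exists>p. - hw \<le> fst p \<and> fst p \<le> hw \<and> f p = i)" for i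
  define S where "S m = {i. 0 \<le> i \<and> i < m \<and> P i}" for m :: int
  have fin: "finite (S m)" for m
    by (rule finite_subset[of _ "{0..<m}"]) (auto simp: S_def)
  have S_in: "S (m + 1) = insert m (S m)" if "P m" "m \<ge> 0" for m
    using that by (auto simp: S_def)
  have S_out: "S (m + 1) = S m" if "\<not> P m" for m
    using that unfolding S_def zless_add1_eq by blast
  have P_walk: "P (f (walk s k))" for k
    using walk_strip[OF assms, of k] unfolding P_def by blast
  have count: "f (walk s k) \<ge> 0 \<and> card (S (f (walk s k))) = k" for k
  proof (induction k)
    case 0
    have "S 0 = {}" by (auto simp: S_def)
    then show ?case by (simp add: walk_0 f)
  next
    case (Suc k)
    let ?p = "walk s k"
    have fd: "f (dir s) = - 1" "f (dir s') = 1"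
      using adj by (simp_all add: f_def lev_def adj_def algebra_simps)
    have fadd: "f (p + q) = f p + f q" "f (p - q) = f p - f q" for p q
      by (simp_all add: f_def lev_add lev_diff)
    have "card (S (f ?p + 1)) = Suc k"
      using S_in[OF P_walk, of k] Suc fin by (simp add: S_def)
    moreover have "f (walk_step s ?p) = f ?p + 1 \<or> f (walk_step s ?p) = f ?p + 2 \<and> \<not> P (f ?p + 1)"
    proof (cases "- hw \<le> fst ?p - den s \<or> fst ?p + den s' \<le> hw")
      case True
      then show ?thesis by (auto simp: walk_step_def fd fadd s'_def[symmetric])
    next
      case False
      then have 2: "fst ?p - den s < - hw" "fst ?p + den s' > hw" "f (walk_step s ?p) = f ?p + 2"
        by (auto simp: walk_step_def fd fadd s'_def[symmetric])
      \<comment> \<open>A strip point with the skipped value would share its column with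
        \<open>?p + dir s'\<close>, which lies outside the strip.\<close>
      have "\<not> P (f ?p + 1)"
      proof
        assume "P (f ?p + 1)"
        then obtain z where z: "- hw \<le> fst z" "fst z \<le> hw" "f z = f ?p + 1"
          unfolding P_def by blast
        have "f (z - (?p + dir s')) = 0" using z fd by (simp add: fadd)
        then have "A * (fst z - (fst ?p + den s')) = B * (snd z - (snd ?p + num s'))"
          by (simp add: f)
        then have "B dvd fst z - (fst ?p + den s')" by (intro dvd[OF dvdI])
        moreover have "\<bar>fst z - (fst ?p + den s')\<bar> < B"
          using 2 z unfolding B_def abs_less_iff by linarith
        ultimately have "fst z - (fst ?p + den s') = 0" by (rule small)
        then show False using 2 z by simp
      qed
      then show ?thesis using 2 by simp
    qed
    ultimately show ?case
      using Suc S_out[of "f ?p + 1"] by (auto simp: walk_Suc add.assoc)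
  qed
  have card_B: "card (S B) = nat (2 * hw + 1)"
  proof -
    \<comment> \<open>Modulo \<open>B\<close> only the column \<open>x\<close> matters, through
      \<open>- A * x\<close>.\<close>
    have "S B = (\<lambda>x. (- A * x) mod B) ` {- hw..hw}"
    proof (intro set_eqI iffI)
      fix i assume "i \<in> S B"
      then obtain p where p: "0 \<le> i" "i < B" "- hw \<le> fst p" "fst p \<le> hw" "f p = i"
        by (auto simp: S_def P_def)
      have "i = (B * snd p - A * fst p) mod B" using p by (simp add: f)
      also have "\<dots> = (- A * fst p) mod B"
        by (metis add_uminus_conv_diff mod_mult_self4 mult_minus_left)
      finally show "i \<in> (\<lambda>x. (- A * x) mod B) ` {- hw..hw}" using p by auto
    next
      fix i assume "i \<in> (\<lambda>x. (- A * x) mod B) ` {- hw..hw}"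
      then obtain x where x: "- hw \<le> x" "x \<le> hw" "i = (- A * x) mod B" by auto
      have "f (x, - ((- A * x) div B)) = i"
        using minus_mult_div_eq_mod[of "- A * x" B] x by (simp add: f)
      then show "i \<in> S B" using x B unfolding S_def P_def by force
    qed
    moreover have "inj_on (\<lambda>x. (- A * x) mod B) {- hw..hw}"
    proof (rule inj_onI)
      fix x y assume xy: "x \<in> {- hw..hw}" "y \<in> {- hw..hw}" "(- A * x) mod B = (- A * y) mod B"
      then have "B dvd - A * x - - A * y" by (simp only: mod_eq_dvd_iff)
      then have "B dvd A * (y - x)" by (simp add: algebra_simps)
      then have "y - x = 0" using xy B by (intro small[OF dvd]) auto
      then show "x = y" by simp
    qed
    ultimately show ?thesis by (simp add: card_image)
  qed
  define M where "M = f (walk s (nat (2 * hw + 1)))"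
  have M: "M \<ge> 0" "card (S M) = nat (2 * hw + 1)" "P M"
    using count P_walk by (auto simp: M_def)
  have "hw \<ge> 0" using t_pos by (simp add: hw_def)
  have "P B" unfolding P_def using \<open>hw \<ge> 0\<close> by (intro exI[of _ "(0, 1)"]) (simp add: f)
  have grow: "card (S m) < card (S m')" if "P m" "0 \<le> m" "m < m'" for m m'
    using that fin by (intro psubset_card_mono) (auto simp: S_def)
  have "M = B"
    using grow[OF M(3,1), of B] grow[OF \<open>P B\<close>, of M] M card_B B by linarith
  then have e: "B * snd (walk s (nat (2 * hw + 1))) - A * fst (walk s (nat (2 * hw + 1))) = B"
    (is "B * ?y - A * ?x = B") by (simp add: M_def f)
  then have "A * ?x = B * (?y - 1)" by (simp add: algebra_simps)
  then have "B dvd ?x" by (intro dvd[OF dvdI])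
  moreover have "\<bar>?x\<bar> < B"
    using walk_strip[OF assms, of "nat (2 * hw + 1)"] B \<open>hw \<ge> 0\<close> unfolding abs_less_iff by linarith
  ultimately have "?x = 0" by (rule small)
  then show ?thesis using e B by (simp add: prod_eq_iff)
qed

section \<open>The layers of the peeling\<close>

definition ed :: "rat \<Rightarrow> int \<times> int" where
  "ed s = (int t div den s * den s, int t div den s * num s)"

text \<open>The right endpoint of the edge of slope \<open>s\<close>, in coordinates in which the edge of slope
  \<open>0\<close> runs from \<open>(-t, 0)\<close> to \<open>(0, 0)\<close>.\<close>
definition vertex0 :: "rat \<Rightarrow> int \<times> int" where
  "vertex0 s = (\<Sum>q | q \<in> slopes t \<and> 0 < q \<and> q \<le> s. ed q) - (\<Sum>q | q \<in> slopes t \<and> s < q \<and> q \<le> 0. ed q)"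

lemma zero_slope: "0 \<in> slopes t"
  using t_pos num_den_of_int[of 0] by (simp add: slopes_iff)

lemma finite_slopes_half:
  "finite {s \<in> slopes t. p < s \<and> s \<le> q}" "finite {s \<in> slopes t. p \<le> s \<and> s < q}"
  by (rule finite_subset[OF _ finite_slopes[of t p q]]; auto)+

lemma vertex0_adj:
  assumes "adj r s" shows "vertex0 s = vertex0 r + ed s"
proof -
  note btw = adj_no_between[OF assms] and sl = adj_slopes[OF assms] and lt = adj_less[OF assms]
  show ?thesis
  proof (cases "0 \<le> r")
    case True
    have 1: "{q. q \<in> slopes t \<and> 0 < q \<and> q \<le> s} = insert s {q. q \<in> slopes t \<and> 0 < q \<and> q \<le> r}"
      using sl lt True btw by force
    have 2: "{q. q \<in> slopes t \<and> s < q \<and> q \<le> 0} = {}" "{q. q \<in> slopes t \<and> r < q \<and> q \<le> 0} = {}"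
      using True lt by auto
    show ?thesis
      unfolding vertex0_def 1 2 using lt finite_slopes_half(1) by (subst sum.insert) auto
  next
    case False
    \<comment> \<open>0 is itself a slope, so no neighbouring pair straddles it.\<close>
    then have "s \<le> 0" using btw[OF zero_slope] by simp
    then have 1: "{q. q \<in> slopes t \<and> r < q \<and> q \<le> 0} = insert s {q. q \<in> slopes t \<and> s < q \<and> q \<le> 0}"
      using sl lt btw by force
    have 2: "{q. q \<in> slopes t \<and> 0 < q \<and> q \<le> s} = {}" "{q. q \<in> slopes t \<and> 0 < q \<and> q \<le> r} = {}"
      using False \<open>s \<le> 0\<close> by auto
    show ?thesis
      unfolding vertex0_def 1 2 using finite_slopes_half(1) by (subst sum.insert) auto
  qed
qed

text \<open>After \<open>k\<close> steps, the point where the edges of slopes \<open>s\<close> and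
  \<open>nxt s\<close> meet. If an edge has length 0, its two ends are the same point under
  different indices.\<close>

definition vertex :: "nat \<Rightarrow> rat \<Rightarrow> int \<times> int" where
  "vertex k s = vertex0 s + walk s k"

lemma vertex_gap:
  assumes "adj r s"
  obtains L where "vertex k s = vertex k r + (L * den s, L * num s)" and "L \<ge> 0"
    and "lev s (vertex (Suc k) s) = lev s (vertex k s) \<or> lev s (vertex (Suc k) s) = lev s (vertex k s) + 1 \<and> L \<le> 1"
proof -
  obtain L where L: "walk s k + ed s = walk r k + (L * den s, L * num s)" "L \<ge> 0"
    "lev s (walk s (Suc k)) = lev s (walk s k) \<or>
      lev s (walk s (Suc k)) = lev s (walk s k) + 1 \<and> L \<le> 1"
    using walk_gap[OF assms, of k] unfolding ed_def by blast
  have "vertex k s = vertex0 r + (walk s k + ed s)" by (simp add: vertex_def vertex0_adj[OF assms] algebra_simps)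
  also have "\<dots> = vertex k r + (L * den s, L * num s)" unfolding L(1) by (simp add: vertex_def algebra_simps)
  finally show thesis
  proof (rule that)
    show "lev s (vertex (Suc k) s) = lev s (vertex k s) \<or> lev s (vertex (Suc k) s) = lev s (vertex k s) + 1 \<and> L \<le> 1"
      using L(3) by (auto simp: vertex_def lev_add)
  qed (rule L(2))
qed

text \<open>The candidate for the \<open>k\<close>-th set of the peeling, cut out by the supporting
  lines of all edges.\<close>

definition layer :: "nat \<Rightarrow> (int \<times> int) set" where
  "layer k = {p. \<forall>s \<in> slopes t. lev s (vertex k s) \<le> lev s p}"

lemma lev_vertex_left:
  assumes "adj r s" shows "lev s (vertex k r) = lev s (vertex k s)"
proof -
  obtain L where "vertex k s = vertex k r + (L * den s, L * num s)" using vertex_gap[OF assms] by metis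
  then show ?thesis using lev_mult[of s L "dir s"] lev_dir_adj[OF assms] by (simp add: lev_add)
qed

text \<open>Moving right over edges steeper than \<open>q\<close>, or left over edges of slope at
  most \<open>q\<close>, never lowers \<open>lev q\<close>.\<close>

lemma vertex_in_layer:
  assumes "s \<in> slopes t" shows "vertex k s \<in> layer k"
proof -
  have "lev q (vertex k q) \<le> lev q (vertex k s)" if q: "q \<in> slopes t" for q
  proof (cases "q \<le> s")
    case True
    from q assms True show ?thesis
    proof (induction rule: adj_induct)
      case (step p p')
      obtain L where L: "vertex k p' = vertex k p + (L * den p', L * num p')" "L \<ge> 0"
        using vertex_gap[OF step(1)] by metis
      have "lev q (dir p') > 0" using step adj_less by (intro lev_dir_pos) force
      then have "L * lev q (dir p') \<ge> 0" using L by simp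
      then show ?case using L step lev_mult[of q L "dir p'"] by (simp add: lev_add)
    qed simp
  next
    case False
    then have "s \<le> q" by simp
    from assms q this show ?thesis
    proof (induction rule: adj_induct_down)
      case (step p p')
      obtain L where L: "vertex k p' = vertex k p + (L * den p', L * num p')" "L \<ge> 0"
        using vertex_gap[OF step(1)] by metis
      have "lev q (dir p') \<le> 0"
        using step(2) lev_dir_neg[of p' q] lev_dir_adj(3)[OF step(1)] by (cases "p' = q") auto
      then have "L * lev q (dir p') \<le> 0" using L by (simp add: mult_nonneg_nonpos)
      then show ?case using L step lev_mult[of q L "dir p'"] by (simp add: lev_add)
    qed simp
  qed
  then show ?thesis by (simp add: layer_def)
qed

lemma vertex_unique_min:
  assumes "adj s s'" "p \<in> layer k" "p \<noteq> vertex k s"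
  shows "lev s (vertex k s) + lev s' (vertex k s) < lev s p + lev s' p"
proof (rule ccontr)
  assume "\<not> ?thesis"
  moreover have "lev s (vertex k s) \<le> lev s p" "lev s' (vertex k s) \<le> lev s' p"
    using assms(2) adj_slopes[OF assms(1)] lev_vertex_left[OF assms(1), of k] by (auto simp: layer_def)
  ultimately have *: "lev s (p - vertex k s) = 0" "lev s' (p - vertex k s) = 0" by (auto simp: lev_diff)
  obtain j where j: "p - vertex k s = (j * den s, j * num s)" using *(1) by (rule lev_eq_zero)
  then have "j * lev s' (dir s) = 0" using *(2) lev_mult[of s' j "dir s"] by simp
  then have "p - vertex k s = 0" using j lev_dir_adj[OF assms(1)] by (simp add: zero_prod_def)
  then show False using assms by simp
qed

text \<open>A vertex is cut off because its successor is higher for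
  \<open>lev s + lev (nxt s)\<close>. Any point cut off lies on an edge that moves to its next line;
  that edge is at most one unit long, so its grid points are its ends.\<close>

lemma layer_Suc: "layer (Suc k) = layer k - vertex k ` slopes t"
proof (intro equalityI subsetI)
  fix p assume p: "p \<in> layer (Suc k)"
  have "lev s (vertex k s) \<le> lev s p" if s: "s \<in> slopes t" for s
  proof -
    obtain r where r: "adj r s" using ex_adj_left[OF s] ..
    have "lev s (vertex k s) \<le> lev s (vertex (Suc k) s)" using vertex_gap[OF r, of k] by fastforce
    then show ?thesis using p s by (force simp: layer_def)
  qed
  then have "p \<in> layer k" by (simp add: layer_def)
  moreover have "p \<noteq> vertex k s" if s: "s \<in> slopes t" for s
  proof
    assume pV: "p = vertex k s"
    note adj = adj_nxt[OF s]
    note l = lev_dir_adj[OF adj] lev_dir_adj(3)[of _ s]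
    have "lev s (dir s) = 0" by (simp add: lev_def)
    \<comment> \<open>Subtracting \<open>dir s\<close> and adding \<open>dir (nxt s)\<close> each
      raise the sum of the two levels by 1.\<close>
    then have "lev s (vertex (Suc k) s) + lev (nxt s) (vertex (Suc k) s) > lev s p + lev (nxt s) p"
      using l by (auto simp: pV vertex_def walk_Suc walk_step_def lev_add lev_diff)
    moreover have "lev s (vertex (Suc k) s) \<le> lev s p" "lev (nxt s) (vertex (Suc k) s) \<le> lev (nxt s) p"
      using p adj_slopes[OF adj] lev_vertex_left[OF adj, of "Suc k"] by (auto simp: layer_def)
    ultimately show False by simp
  qed
  ultimately show "p \<in> layer k - vertex k ` slopes t" by blast
next
  fix p assume p: "p \<in> layer k - vertex k ` slopes t"
  show "p \<in> layer (Suc k)"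
  proof (rule ccontr)
    assume "p \<notin> layer (Suc k)"
    then obtain s where s: "s \<in> slopes t" "lev s p < lev s (vertex (Suc k) s)" by (auto simp: layer_def)
    obtain r where r: "adj r s" using ex_adj_left[OF s(1)] ..
    note adj = adj_nxt[OF s(1)]
    obtain L where L: "vertex k s = vertex k r + (L * den s, L * num s)"
      "lev s (vertex (Suc k) s) = lev s (vertex k s) \<or> lev s (vertex (Suc k) s) = lev s (vertex k s) + 1 \<and> L \<le> 1"
      using vertex_gap[OF r, of k] by metis
    have pA: "lev q (vertex k q) \<le> lev q p" if "q \<in> slopes t" for q using p that by (auto simp: layer_def)
    have "lev s p = lev s (vertex k s)" "L \<le> 1" using L(2) s pA[OF s(1)] by auto
    then have "lev s (p - vertex k r) = 0" using lev_vertex_left[OF r] by (simp add: lev_diff)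
    then obtain j where j: "p - vertex k r = (j * den s, j * num s)" by (rule lev_eq_zero)
    have "lev r (p - vertex k r) \<ge> 0" using pA[OF adj_slopes(1)[OF r]] by (simp add: lev_diff)
    then have "j \<ge> 0" using j lev_mult[of r j "dir s"] lev_dir_adj[OF r] by simp
    moreover have "lev (nxt s) (p - vertex k s) \<ge> 0"
      using pA[OF adj_slopes(2)[OF adj]] lev_vertex_left[OF adj] by (simp add: lev_diff)
    moreover have pL: "p - vertex k s = ((j - L) * den s, (j - L) * num s)"
      using j L(1) by (simp add: prod_eq_iff algebra_simps)
    \<comment> \<open>The lines of slopes \<open>r\<close> and \<open>nxt s\<close> confine
      \<open>p\<close> to 0 \<le> j \<le> L.\<close>
    ultimately have "j = 0 \<or> j = L"
      using lev_mult[of "nxt s" "j - L" "dir s"] lev_dir_adj[OF adj] \<open>L \<le> 1\<close> by auto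
    then have "p = vertex k r \<or> p = vertex k s" using j pL by (auto simp: prod_eq_iff)
    then show False using p adj_slopes[OF r] by auto
  qed
qed

section \<open>Vertices on both sides of every column\<close>

lemma fst_vertex0_less:
  assumes "r \<in> slopes t" "s \<in> slopes t" "r < s" shows "fst (vertex0 r) < fst (vertex0 s)"
proof -
  have "r \<le> s" using assms by simp
  with assms(1,2) have "s = r \<or> fst (vertex0 r) < fst (vertex0 s)"
  proof (induction rule: adj_induct)
    case (step p q)
    have "den q > 0" "den q \<le> int t" using adj_slopes[OF step(1)] den_pos by (auto simp: slopes_iff)
    then have "int t div den q * den q > 0" by (simp add: pos_imp_zdiv_pos_iff)
    then have "fst (vertex0 p) < fst (vertex0 q)" using vertex0_adj[OF step(1)] by (simp add: ed_def)
    then show ?case using step by auto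
  qed simp
  then show ?thesis using assms by simp
qed

lemma of_int_slope: "of_int m \<in> slopes t"
  using t_pos by (simp add: slopes_iff num_den_of_int)

lemma vertex0_unbounded:
  "int m \<le> fst (vertex0 (of_int (int m)))" "fst (vertex0 (of_int (- int m))) \<le> - int m"
proof -
  have V00: "fst (vertex0 0) = 0"
  proof -
    have e: "{q. q \<in> slopes t \<and> 0 < q \<and> q \<le> 0} = {}" by auto
    show ?thesis unfolding vertex0_def e by simp
  qed
  show "int m \<le> fst (vertex0 (of_int (int m)))"
  proof (induction m)
    case (Suc m)
    then show ?case
      using fst_vertex0_less[of "of_int (int m)" "of_int (int (Suc m))"] of_int_slope
      by (simp only: of_int_less_iff) simp
  qed (simp add: V00)
  show "fst (vertex0 (of_int (- int m))) \<le> - int m"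
  proof (induction m)
    case (Suc m)
    then show ?case
      using fst_vertex0_less[of "of_int (- int (Suc m))" "of_int (- int m)"] of_int_slope
      by (simp only: of_int_less_iff) simp
  qed (simp add: V00)
qed

text \<open>A discrete intermediate value argument along the chain of vertices, which extends
  arbitrarily far both ways.\<close>

lemma vertex_cover: "\<exists>r s. adj r s \<and> fst (vertex k r) \<le> x \<and> x \<le> fst (vertex k s)"
proof -
  \<comment> \<open>The walk displaces a vertex by at most \<open>hw\<close> columns; the extra 1
    makes the bound on the right strict.\<close>
  define m where "m = nat (\<bar>x\<bar> + hw + 1)"
  have m: "int m = \<bar>x\<bar> + hw + 1" by (simp add: m_def hw_def)
  let ?l = "of_int (- int m) :: rat" and ?u = "of_int (int m) :: rat"
  have l: "fst (vertex k ?l) \<le> x" and u: "x < fst (vertex k ?u)"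
    using vertex0_unbounded[of m] m walk_strip[OF of_int_slope, of "- int m" k]
      walk_strip[OF of_int_slope, of "int m" k]
    by (simp_all only: vertex_def fst_add) linarith+
  have le: "?l \<le> ?u" by simp
  from of_int_slope of_int_slope le
  have "fst (vertex k ?u) \<le> x \<or> ?thesis"
  proof (induction rule: adj_induct)
    case (step p q)
    then show ?case by (meson linear)
  qed (use l in simp)
  then show ?thesis using u by simp
qed

section \<open>Layers and convex hulls in the real plane\<close>

definition emb :: "int \<times> int \<Rightarrow> real \<times> real" where
  "emb p = (real t / 2 + of_int (fst p), of_int (snd p))"

lemma inj_emb: "inj emb"
  by (rule injI) (simp add: emb_def prod_eq_iff)

lemma layer_up:
  assumes "p \<in> layer k" shows "p + (0, 1) \<in> layer k"
proof -
  have "lev s p < lev s (p + (0, 1))" for s using den_pos[of s] by (simp add: lev_def algebra_simps)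
  then show ?thesis using assms unfolding layer_def by (force intro: order_trans less_imp_le)
qed

lemma point_below:
  assumes "adj r s" "p \<in> layer k" "fst (vertex k r) \<le> fst p" "fst p \<le> fst (vertex k s)"
  obtains q where "q \<in> closed_segment (emb (vertex k r)) (emb (vertex k s))"
    "fst q = fst (emb p)" "snd q \<le> snd (emb p)"
proof -
  obtain L where L: "vertex k s = vertex k r + (L * den s, L * num s)" "L \<ge> 0" using vertex_gap[OF assms(1)] by metis
  define d where "d = fst p - fst (vertex k r)"
  \<comment> \<open>If \<open>L = 0\<close>, the edge is a single point and \<open>d = 0\<close>, so
    any weight would do.\<close>
  define u where "u = (if L = 0 then 0 else real_of_int d / (L * den s))"
  have d: "0 \<le> d" "d \<le> L * den s" using assms(3,4) L(1) by (auto simp: d_def)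
  have u: "0 \<le> u" "u \<le> 1" and uL: "u * (L * den s) = d"
    using d L(2) den_pos[of s] by (auto simp: u_def divide_simps simp flip: of_int_mult)
  define q where "q = (1 - u) *\<^sub>R emb (vertex k r) + u *\<^sub>R emb (vertex k s)"
  have "q \<in> closed_segment (emb (vertex k r)) (emb (vertex k s))"
    using u unfolding q_def closed_segment_def by blast
  moreover have "fst q = fst (emb p)"
  proof -
    have "fst q = real t / 2 + fst (vertex k r) + u * (L * den s)"
      by (simp add: q_def emb_def L(1) field_simps)
    then show ?thesis using uL by (simp add: emb_def d_def)
  qed
  moreover have "snd q \<le> snd (emb p)"
  proof -
    have "lev s (vertex k r) \<le> lev s p"
      using assms(2) adj_slopes[OF assms(1)] lev_vertex_left[OF assms(1)] by (auto simp: layer_def)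
    then have "num s * d \<le> den s * (snd p - snd (vertex k r))" by (simp add: lev_def d_def algebra_simps)
    then have "real_of_int (num s * d) \<le> real_of_int (den s * (snd p - snd (vertex k r)))"
      by (simp only: of_int_le_iff)
    then have "num s * (u * (L * den s)) \<le> den s * (real_of_int (snd p) - snd (vertex k r))"
      using uL by simp
    then have "den s * (u * (L * num s)) \<le> den s * (real_of_int (snd p) - snd (vertex k r))"
      by (simp add: algebra_simps)
    then have "u * (L * num s) \<le> real_of_int (snd p) - snd (vertex k r)"
      using den_pos[of s] by simp
    then show ?thesis by (simp add: q_def emb_def L(1) algebra_simps)
  qed
  ultimately show thesis by (rule that)
qed

lemma extreme_vertex:
  assumes "s \<in> slopes t" shows "emb (vertex k s) extreme_point_of (convex hull (emb ` layer k))"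
proof -
  define s' where "s' = nxt s"
  have adj: "adj s s'" using adj_nxt[OF assms] by (simp add: s'_def)
  \<comment> \<open>Normal to the mediant slope, so up to a constant its form is
    \<open>lev s + lev s'\<close>.\<close>
  define c :: "real \<times> real" where "c = (- of_int (num s + num s'), of_int (den s + den s'))"
  have c: "c \<bullet> emb p = of_int (lev s p + lev s' p) - of_int (num s + num s') * (real t / 2)" for p
    by (simp add: c_def emb_def lev_def inner_prod_def algebra_simps)
  show ?thesis
  proof (rule extreme_point_of_unique_min)
    fix y assume y: "y \<in> emb ` layer k" "y \<noteq> emb (vertex k s)"
    then obtain p where p: "p \<in> layer k" "y = emb p" by blast
    then have "p \<noteq> vertex k s" using y by blast
    then show "c \<bullet> emb (vertex k s) < c \<bullet> y"
      using vertex_unique_min[OF adj p(1)] unfolding p(2) c by simp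
  qed (use vertex_in_layer assms in blast)
qed

text \<open>The point \<open>q\<close> of the lower chain in the column of \<open>p\<close> either
  is \<open>p\<close>, which is then interior to an edge, or lies strictly below; then
  \<open>p\<close> is between \<open>q\<close> and the next grid point above
  \<open>p\<close>.\<close>

lemma not_extreme_nonvertex:
  assumes "p \<in> layer k" "p \<notin> vertex k ` slopes t"
  shows "\<not> emb p extreme_point_of (convex hull (emb ` layer k))"
proof -
  let ?C = "convex hull (emb ` layer k)"
  obtain r s where rs: "adj r s" "fst (vertex k r) \<le> fst p" "fst p \<le> fst (vertex k s)" using vertex_cover by blast
  note sl = adj_slopes[OF rs(1)]
  obtain q where q: "q \<in> closed_segment (emb (vertex k r)) (emb (vertex k s))"
    "fst q = fst (emb p)" "snd q \<le> snd (emb p)"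
    using point_below[OF rs(1) assms(1) rs(2,3)] .
  have in_C: "emb z \<in> ?C" if "z \<in> layer k" for z using that by (intro hull_inc) auto
  have vertex: "emb (vertex k r) \<in> ?C" "emb (vertex k s) \<in> ?C" using in_C vertex_in_layer sl by auto
  have qC: "q \<in> ?C" using q(1) closed_segment_subset_convex_hull[OF vertex] by (simp add: hull_hull) blast
  have upC: "emb (p + (0, 1)) \<in> ?C" using in_C layer_up assms by blast
  show ?thesis
  proof (cases "q = emb p")
    case True
    have "emb p \<noteq> emb (vertex k r)" "emb p \<noteq> emb (vertex k s)" using assms sl injD[OF inj_emb] by blast+
    then have "emb p \<in> open_segment (emb (vertex k r)) (emb (vertex k s))"
      using q(1) True by (simp add: open_segment_def)
    then show ?thesis using vertex unfolding extreme_point_of_def by blast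
  next
    case False
    define c where "c = snd (emb p) - snd q"
    have c: "c > 0" using False q by (auto simp: c_def prod_eq_iff)
    \<comment> \<open>The weight at which the drop \<open>c\<close> to \<open>q\<close> and the rise
      1 to the upper point cancel.\<close>
    define v where "v = c / (c + 1)"
    have v: "0 < v" "v < 1" "v * (c + 1) = c" using c by (auto simp: v_def)
    have "emb p = (1 - v) *\<^sub>R q + v *\<^sub>R emb (p + (0, 1))"
    proof (rule prod_eqI)
      show "fst (emb p) = fst ((1 - v) *\<^sub>R q + v *\<^sub>R emb (p + (0, 1)))"
        using q(2) by (simp add: emb_def field_simps)
      have "snd ((1 - v) *\<^sub>R q + v *\<^sub>R emb (p + (0, 1))) = snd (emb p) - c + v * (c + 1)"
        by (simp add: emb_def c_def algebra_simps)
      then show "snd (emb p) = snd ((1 - v) *\<^sub>R q + v *\<^sub>R emb (p + (0, 1)))" using v by simp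
    qed
    then have "emb p \<in> open_segment q (emb (p + (0, 1)))"
      unfolding in_segment using v q(3) by (intro conjI exI[of _ v]) (auto simp: emb_def)
    then show ?thesis using qC upC unfolding extreme_point_of_def by blast
  qed
qed

lemma peel_layer: "peel (emb ` layer k) = emb ` layer (Suc k)"
proof -
  have "emb p extreme_point_of (convex hull (emb ` layer k)) \<longleftrightarrow> p \<in> vertex k ` slopes t" if "p \<in> layer k" for p
    using that extreme_vertex not_extreme_nonvertex by blast
  then show ?thesis unfolding peel_def layer_Suc by blast
qed

lemma peel_funpow_layer: "(peel ^^ k) (emb ` layer 0) = emb ` layer k"
  by (induction k) (simp_all add: peel_layer)

text \<open>By \<open>walk_period\<close> every bounding line is translated by (0, 1).\<close>

lemma layer_period: "emb ` layer (nat (2 * hw + 1)) = (\<lambda>p. p + (0, 1)) ` emb ` layer 0"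
proof -
  have "lev s (vertex (nat (2 * hw + 1)) s) \<le> lev s (p + (0, 1)) \<longleftrightarrow> lev s (vertex 0 s) \<le> lev s p"
    if "s \<in> slopes t" for s p
    using walk_period[OF that] by (simp add: vertex_def walk_0 lev_def algebra_simps)
  then have *: "p + (0, 1) \<in> layer (nat (2 * hw + 1)) \<longleftrightarrow> p \<in> layer 0" for p by (auto simp: layer_def)
  have "layer (nat (2 * hw + 1)) = (\<lambda>p. p + (0, 1)) ` layer 0"
  proof (intro equalityI subsetI)
    fix p assume "p \<in> layer (nat (2 * hw + 1))"
    then show "p \<in> (\<lambda>p. p + (0, 1)) ` layer 0"
      using *[of "p - (0, 1)"] by (intro image_eqI[of _ _ "p - (0, 1)"]) auto
  qed (use * in auto)
  moreover have "emb (p + (0, 1)) = emb p + (0, 1)" for p by (simp add: emb_def prod_eq_iff)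
  ultimately show ?thesis by (simp add: image_image)
qed

section \<open>The grid parabola as the boundary of the initial layer\<close>

lemma gvec_ed: "gvec t s = (of_int (fst (ed s)), of_int (snd (ed s)))"
  by (simp add: gvec_def ed_def num_def den_def split: prod.split)

lemma edge_eq:
  assumes "adj r s" shows "edge t s = closed_segment (emb (vertex0 r)) (emb (vertex0 s))"
proof -
  note btw = adj_no_between[OF assms] and sl = adj_slopes[OF assms] and lt = adj_less[OF assms]
  have r: "emb (vertex0 r) = emb (vertex0 s) - gvec t s"
    by (simp add: vertex0_adj[OF assms] gvec_ed emb_def prod_eq_iff)
  have ed0: "ed 0 = (int t, 0)" using num_den_of_int[of 0] by (simp add: ed_def)
  have sum: "(\<Sum>q\<in>Q. gvec t q) = (of_int (fst (\<Sum>q\<in>Q. ed q)), of_int (snd (\<Sum>q\<in>Q. ed q)))" for Q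
    by (simp add: prod_eq_iff fst_sum snd_sum gvec_ed)
  consider "s = 0" | "s > 0" | "s < 0" by linarith
  then show ?thesis
  proof cases
    case 1
    have e: "{q. q \<in> slopes t \<and> 0 < q \<and> q \<le> 0} = {}" by auto
    have "vertex0 s = 0" unfolding vertex0_def 1 e by simp
    then have "emb (vertex0 s) = (real t / 2, 0)" by (simp add: emb_def)
    moreover have "gvec t s = (real t, 0)" by (simp add: 1 gvec_ed ed0)
    ultimately show ?thesis using r by (simp add: edge_def 1)
  next
    case 2
    have e: "{q. q \<in> slopes t \<and> s < q \<and> q \<le> 0} = {}" using 2 by auto
    have "right_end t s = emb (vertex0 s)"
      unfolding right_end_def vertex0_def e sum by (simp add: emb_def)
    then show ?thesis using 2 r by (simp add: edge_def)
  next
    case 3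
    have e: "{q. q \<in> slopes t \<and> 0 < q \<and> q \<le> r} = {}" using 3 lt by auto
    \<comment> \<open>The additional slope 0 contributes (t, 0), the offset between the two base
      points of \<open>left_end\<close> and \<open>right_end\<close>.\<close>
    have i: "{q. q \<in> slopes t \<and> r < q \<and> q \<le> 0} = insert 0 {q \<in> slopes t. s \<le> q \<and> q < 0}"
      using 3 lt btw zero_slope by force
    have "vertex0 r = - ((int t, 0) + (\<Sum>q\<in>{q \<in> slopes t. s \<le> q \<and> q < 0}. ed q))"
      unfolding vertex0_def e i using finite_slopes_half(2) by (subst sum.insert) (auto simp: ed0)
    then have "left_end t s = emb (vertex0 r)"
      unfolding left_end_def sum by (simp add: emb_def)
    then show ?thesis using 3 r by (simp add: edge_def)
  qed
qed

lemma U0_eq_layer: "U0 t = emb ` layer 0"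
proof (intro equalityI subsetI)
  fix z assume z: "z \<in> U0 t"
  then obtain m n where "z = (real t / 2 + of_int m, of_int n)" by (auto simp: U0_def grid_def)
  then have p: "z = emb (m, n)" by (simp add: emb_def)
  from z obtain q s where q: "s \<in> slopes t" "q \<in> edge t s" "fst q = fst z" "snd q \<le> snd z"
    by (auto simp: U0_def grid_parabola_def)
  obtain r where r: "adj r s" using ex_adj_left[OF q(1)] ..
  have vertex_0: "vertex 0 w = vertex0 w" for w by (simp add: vertex_def walk_0 prod_eq_iff)
  obtain u where u: "0 \<le> u" "u \<le> 1" and qu: "q = (1 - u) *\<^sub>R emb (vertex0 r) + u *\<^sub>R emb (vertex0 s)"
    using q(2) unfolding edge_eq[OF r] closed_segment_def by blast
  have "lev w (vertex 0 w) \<le> lev w (m, n)" if w: "w \<in> slopes t" for w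
  proof -
    \<comment> \<open>\<open>f\<close> extends \<open>lev w\<close> to the real plane: a lower bound
      at both ends of an edge holds along the edge and persists upwards.\<close>
    define f where "f y = of_int (den w) * snd y - of_int (num w) * (fst y - real t / 2)" for y :: "real \<times> real"
    have fe: "f (emb y) = of_int (lev w y)" for y by (simp add: f_def emb_def lev_def)
    have "vertex0 r \<in> layer 0" "vertex0 s \<in> layer 0" using vertex_in_layer[of r 0] vertex_in_layer[of s 0] adj_slopes[OF r] by (auto simp: vertex_0)
    then have le: "of_int (lev w (vertex 0 w)) \<le> f (emb (vertex0 r))" "of_int (lev w (vertex 0 w)) \<le> f (emb (vertex0 s))"
      using w unfolding fe by (auto simp: layer_def)
    have "of_int (lev w (vertex 0 w)) = (1 - u) * of_int (lev w (vertex 0 w)) + u * of_int (lev w (vertex 0 w))"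
      by (simp add: algebra_simps)
    also have "\<dots> \<le> (1 - u) * f (emb (vertex0 r)) + u * f (emb (vertex0 s))"
      using u le by (intro add_mono mult_left_mono) auto
    also have "\<dots> = f q" by (simp add: qu f_def field_simps)
    also have "\<dots> \<le> f z" using q den_pos[of w] by (simp add: f_def)
    also have "\<dots> = of_int (lev w (m, n))" unfolding p fe ..
    finally show ?thesis by simp
  qed
  then show "z \<in> emb ` layer 0" unfolding p by (intro imageI) (simp add: layer_def)
next
  fix z assume "z \<in> emb ` layer 0"
  then obtain p where p: "p \<in> layer 0" "z = emb p" by blast
  obtain r s where rs: "adj r s" "fst (vertex 0 r) \<le> fst p" "fst p \<le> fst (vertex 0 s)" using vertex_cover by blast
  obtain q where "q \<in> edge t s" "fst q = fst z" "snd q \<le> snd z"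
    using point_below[OF rs(1) p(1) rs(2,3)] p(2) edge_eq[OF rs(1)] by (auto simp: vertex_def walk_0 simp flip: zero_prod_def)
  then show "z \<in> U0 t"
    using adj_slopes[OF rs(1)] p(2) by (force simp: U0_def grid_parabola_def grid_def emb_def)
qed

lemma peel_period: "(peel ^^ nat (2 * hw + 1)) (U0 t) = (\<lambda>p. p + (0, 1)) ` U0 t"
  unfolding U0_eq_layer peel_funpow_layer layer_period ..

end

theorem theorem2:
  fixes t :: nat
  assumes "t \<ge> 1"
  shows "(odd t \<longrightarrow> (peel ^^ t) (U0 t) = (\<lambda>p. p + (0, 1)) ` U0 t) \<and>
         (even t \<longrightarrow> (peel ^^ (t + 1)) (U0 t) = (\<lambda>p. p + (0, 1)) ` U0 t)"
proof -
  interpret grid_peeling t by unfold_locales (rule assms)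
  have "nat (2 * hw + 1) = (if odd t then t else t + 1)" by (auto simp: hw_def elim: oddE evenE)
  then show ?thesis using peel_period by (auto split: if_splits)
qed

end
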